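(* Let $\mathcal{T}=\mathcal{A}+\mathrm{i}\mathcal{B}\in\mathbb{C}^{n\times n\times n_3}$ with $\mathcal{A},\mathcal{B}\in\mathbb{R}^{n\times n\times n_3}$ real symmetric tensors. Let $\alpha_j$ and $\beta_j$ $(j=1,\dots,nn_3)$ be the t-eigenvalues of $\mathcal{A}$ and $\mathcal{B}$ respectively, ordered such that $|\alpha_1|\ge|\alpha_2|\ge\cdots\ge|\alpha_{nn_3}|$ and $|\beta_1|\ge|\beta_2|\ge\cdots\ge|\beta_{nn_3}|$. Then $$\frac1{n_3}\big\|\mathrm{diag}(\alpha_1+\mathrm{i}\beta_1,\dots,\alpha_{nn_3}+\mathrm{i}\beta_{nn_3})\big\|_F\le\sqrt2\,\|\mathcal{T}\|_F$$ and $$\big\|\mathrm{diag}(\alpha_1+\mathrm{i}\beta_1,\dots,\alpha_{nn_3}+\mathrm{i}\beta_{nn_3})\big\|_2\le\sqrt2\,\|\mathcal{T}\|_2.$$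
   Context: Here $\mathrm{i}=\sqrt{-1}$. For a real or complex $n_1\times n_2\times n_3$ tensor $\mathcal{A}$ with frontal slices $A^{(1)},\dots,A^{(n_3)}$ (each $n_1\times n_2$), $\mathrm{bcirc}(\mathcal{A})$ is the $n_1n_3\times n_2n_3$ block circulant matrix whose first block column is $A^{(1)},A^{(2)},\dots,A^{(n_3)}$ (top to bottom), i.e. its $(i,j)$ block is $A^{(((i-j)\bmod n_3)+1)}$. $\mathrm{unfold}(\mathcal{A})$ is the first block column of $\mathrm{bcirc}(\mathcal{A})$ and $\mathrm{fold}$ is its inverse. The t-product is $\mathcal{A}*\mathcal{B}=\mathrm{fold}(\mathrm{bcirc}(\mathcal{A})\cdot\mathrm{unfold}(\mathcal{B}))$. The transpose $\mathcal{A}^{T}$ of a real tensor is obtained by transposing each frontal slice and reversing the order of the transposed slices $2,\dots,n_3$; $\mathcal{A}$ is symmetric if $\mathcal{A}^T=\mathcal{A}$. A scalar $\lambda\in\mathbb{C}$ is a t-eigenvalue of an $n\times n\times n_3$ tensor $\mathcal{A}$ if $\mathcal{A}*\mathcal{X}=\lambda\mathcal{X}$ for some nonzero $\mathcal{X}\in\mathbb{C}^{n\times1\times n_3}$; equivalently, the t-eigenvalues are the $nn_3$ eigenvalues of $\mathrm{bcirc}(\mathcal{A})$, and they are counted with algebraic multiplicity as such. Tensor norms: $\|\mathcal{A}\|_F=\sqrt{\sum_{i,j,k}|a_{ijk}|^2}$ and $\|\mathcal{A}\|_2=\|\mathrm{bcirc}(\mathcal{A})\|_2$. For matrices $\|\cdot\|_F$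 and $\|\cdot\|_2$ are the usual Frobenius and spectral norms. *)

theory Defs
  imports
    "Jordan_Normal_Form.Char_Poly"
    "Jordan_Normal_Form.Jordan_Normal_Form_Existence"
    "HOL-Analysis.L2_Norm"
begin

section \<open>Third-order tensors and the t-product\<close>

text \<open>A tensor is the list of its frontal slices. Slices, rows and columns are numbered from 0,
  so \<open>A ! k\<close> is the slice written $A^{(k+1)}$ on paper.\<close>

type_synonym 'a tensor = "'a mat list"

definition carrier_tensor :: "nat \<Rightarrow> nat \<Rightarrow> nat \<Rightarrow> 'a tensor set" where
  "carrier_tensor n1 n2 n3 = {A. length A = n3 \<and> set A \<subseteq> carrier_mat n1 n2}"

text \<open>In block \<open>(i, j)\<close> the summand \<open>length A\<close> keeps the natural-number subtraction
  \<open>i - j\<close> from being truncated.\<close>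

definition bcirc :: "'a tensor \<Rightarrow> 'a mat" where
  "bcirc A = (let n1 = dim_row (A ! 0); n2 = dim_col (A ! 0); n3 = length A in
     mat (n1 * n3) (n2 * n3) (\<lambda>(r, c).
       A ! ((r div n1 + n3 - c div n2) mod n3) $$ (r mod n1, c mod n2)))"

definition t_unfold :: "'a tensor \<Rightarrow> 'a mat" where
  "t_unfold A = (let n1 = dim_row (A ! 0); n2 = dim_col (A ! 0); n3 = length A in
     mat (n1 * n3) n2 (\<lambda>(r, c). A ! (r div n1) $$ (r mod n1, c)))"

definition t_fold :: "nat \<Rightarrow> 'a mat \<Rightarrow> 'a tensor" where
  "t_fold n3 M = (let n1 = dim_row M div n3 in
     map (\<lambda>k. mat n1 (dim_col M) (\<lambda>(i, j). M $$ (k * n1 + i, j))) [0..<n3])"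

definition t_prod :: "'a :: semiring_0 tensor \<Rightarrow> 'a tensor \<Rightarrow> 'a tensor" where
  "t_prod A B = t_fold (length A) (bcirc A * t_unfold B)"

definition t_add :: "'a :: plus tensor \<Rightarrow> 'a tensor \<Rightarrow> 'a tensor" where
  "t_add A B = map2 (+) A B"

definition t_smult :: "'a :: times \<Rightarrow> 'a tensor \<Rightarrow> 'a tensor" where
  "t_smult c A = map (\<lambda>M. c \<cdot>\<^sub>m M) A"

definition t_zero :: "nat \<Rightarrow> nat \<Rightarrow> nat \<Rightarrow> 'a :: zero tensor" where
  "t_zero n1 n2 n3 = replicate n3 (0\<^sub>m n1 n2)"

definition t_of_real :: "real tensor \<Rightarrow> complex tensor" where
  "t_of_real A = map (map_mat complex_of_real) A"

fun t_transpose :: "real tensor \<Rightarrow> real tensor" where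
  "t_transpose [] = []"
| "t_transpose (M # Ms) = transpose_mat M # rev (map transpose_mat Ms)"

definition t_symmetric :: "real tensor \<Rightarrow> bool" where
  "t_symmetric A \<longleftrightarrow> t_transpose A = A"


section \<open>t-eigenvalues\<close>

definition t_eigenvalue :: "complex tensor \<Rightarrow> complex \<Rightarrow> bool" where
  "t_eigenvalue A ev \<longleftrightarrow> (let n = dim_row (A ! 0); n3 = length A in
     \<exists>X \<in> carrier_tensor n 1 n3. X \<noteq> t_zero n 1 n3 \<and> t_prod A X = t_smult ev X)"

text \<open>The list consists of exactly the t-eigenvalues, each repeated according to its algebraic
  multiplicity as an eigenvalue of the block circulant matrix.\<close>

definition t_eigenvalue_list :: "complex tensor \<Rightarrow> complex list \<Rightarrow> bool" where
  "t_eigenvalue_list A evs \<longleftrightarrow>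
     set evs = {ev. t_eigenvalue A ev} \<and>
     (\<forall>ev \<in> set evs. count_list evs ev = order ev (char_poly (bcirc A)))"


section \<open>Norms\<close>

definition frobenius_norm :: "complex mat \<Rightarrow> real" where
  "frobenius_norm M = sqrt (\<Sum>i<dim_row M. \<Sum>j<dim_col M. (cmod (M $$ (i, j)))\<^sup>2)"

definition vec_l2_norm :: "complex vec \<Rightarrow> real" where
  "vec_l2_norm v = L2_set (\<lambda>i. cmod (v $ i)) {..<dim_vec v}"

text \<open>The spectral norm is the operator norm induced by the Euclidean norm. The supremum is
  meaningful for matrices with at least one column: the set below is then nonempty, and it is
  always bounded above (lemma \<open>bdd_above_spectral_norm\<close>).\<close>

definition spectral_norm :: "complex mat \<Rightarrow> real" where
  "spectral_norm M =
     (SUP v \<in> {v \<in> carrier_vec (dim_col M). vec_l2_norm v = 1}. vec_l2_norm (M *\<^sub>v v))"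

definition t_frobenius_norm :: "complex tensor \<Rightarrow> real" where
  "t_frobenius_norm A = sqrt (\<Sum>k<length A. \<Sum>i<dim_row (A ! k). \<Sum>j<dim_col (A ! k).
     (cmod (A ! k $$ (i, j)))\<^sup>2)"

definition t_spectral_norm :: "complex tensor \<Rightarrow> real" where
  "t_spectral_norm A = spectral_norm (bcirc A)"


section \<open>Consistency of the definitions\<close>

lemma carrier_tensor_nth:
  assumes "A \<in> carrier_tensor n1 n2 n3" "k < n3"
  shows "A ! k \<in> carrier_mat n1 n2"
  using assms nth_mem[of k A] by (auto simp: carrier_tensor_def)

lemma bcirc_carrier:
  assumes "A \<in> carrier_tensor n1 n2 n3" "n3 > 0"
  shows "bcirc A \<in> carrier_mat (n1 * n3) (n2 * n3)"
  using assms carrier_tensor_nth[OF assms] by (auto simp: bcirc_def Let_def carrier_tensor_def)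

lemma t_unfold_carrier:
  assumes "A \<in> carrier_tensor n1 n2 n3" "n3 > 0"
  shows "t_unfold A \<in> carrier_mat (n1 * n3) n2"
  using assms carrier_tensor_nth[OF assms] by (auto simp: t_unfold_def Let_def carrier_tensor_def)

lemma t_fold_carrier:
  assumes "M \<in> carrier_mat (n1 * n3) n2" "n3 > 0"
  shows "t_fold n3 M \<in> carrier_tensor n1 n2 n3"
  using assms by (auto simp: t_fold_def Let_def carrier_tensor_def)

lemma t_fold_unfold:
  assumes A: "A \<in> carrier_tensor n1 n2 n3" and n3: "n3 > 0"
  shows "t_fold n3 (t_unfold A) = A"
proof (rule nth_equalityI)
  show "length (t_fold n3 (t_unfold A)) = length A"
    using A by (simp add: t_fold_def Let_def carrier_tensor_def)
next
  fix k assume "k < length (t_fold n3 (t_unfold A))"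
  hence k: "k < n3" by (simp add: t_fold_def Let_def)
  have len: "length A = n3" using A by (simp add: carrier_tensor_def)
  have bound: "k * n1 + i < n1 * n3" if "i < n1" for i
  proof -
    have "k * n1 + i < Suc k * n1" using that by simp
    also have "\<dots> \<le> n3 * n1" using k by (intro mult_right_mono) auto
    finally show ?thesis by (simp add: mult.commute)
  qed
  show "t_fold n3 (t_unfold A) ! k = A ! k"
    using carrier_tensor_nth[OF A k] carrier_tensor_nth[OF A n3] k n3 len bound
    by (intro eq_matI) (auto simp: t_fold_def t_unfold_def Let_def)
qed

lemma t_unfold_fold:
  assumes M: "M \<in> carrier_mat (n1 * n3) n2" and n3: "n3 > 0"
  shows "t_unfold (t_fold n3 M) = M"
proof (rule eq_matI)
  fix r c assume "r < dim_row M" "c < dim_col M"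
  hence r: "r < n1 * n3" "c < n2" using M by auto
  hence "n1 > 0" by (cases n1) auto
  hence *: "r mod n1 < n1" "r div n1 < n3" using r
    by (auto simp: less_mult_imp_div_less mult.commute)
  show "t_unfold (t_fold n3 M) $$ (r, c) = M $$ (r, c)"
    using M n3 r * by (simp add: t_fold_def t_unfold_def Let_def)
qed (use M n3 in \<open>auto simp: t_fold_def t_unfold_def Let_def\<close>)

lemma t_unfold_first_block_column:
  assumes A: "A \<in> carrier_tensor n1 n2 n3" "n3 > 0" and r: "r < n1 * n3" "c < n2"
  shows "bcirc A $$ (r, c) = t_unfold A $$ (r, c)"
proof -
  have "r div n1 < n3" using r by (simp add: less_mult_imp_div_less mult.commute)
  moreover have "c < n2 * n3" using r A(2) by (cases n3) auto
  ultimately show ?thesis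
    using A r carrier_tensor_nth[OF A]
    by (auto simp: bcirc_def t_unfold_def Let_def carrier_tensor_def)
qed

lemma t_eigenvalue_iff_bcirc:
  assumes A: "A \<in> carrier_tensor n n n3" and n3: "n3 > 0"
  shows "t_eigenvalue A ev \<longleftrightarrow> eigenvalue (bcirc A) ev"
proof -
  let ?C = "bcirc A" and ?N = "n * n3"
  have C: "?C \<in> carrier_mat ?N ?N" using bcirc_carrier[OF A n3] .
  have len: "length A = n3" using A by (simp add: carrier_tensor_def)
  have dim: "dim_row (A ! 0) = n" using carrier_tensor_nth[OF A n3] by auto
  have smult: "t_fold n3 (ev \<cdot>\<^sub>m M) = t_smult ev (t_fold n3 M)"
    if M: "M \<in> carrier_mat ?N 1" for M
  proof (rule nth_equalityI)
    fix k assume "k < length (t_fold n3 (ev \<cdot>\<^sub>m M))"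
    hence k: "k < n3" by (simp add: t_fold_def Let_def)
    have "k * n + i < ?N" if "i < n" for i
    proof -
      have "k * n + i < Suc k * n" using that by simp
      also have "\<dots> \<le> n3 * n" using k by (intro mult_right_mono) auto
      finally show ?thesis by (simp add: mult.commute)
    qed
    thus "t_fold n3 (ev \<cdot>\<^sub>m M) ! k = t_smult ev (t_fold n3 M) ! k"
      using M k n3 by (intro eq_matI) (auto simp: t_fold_def t_smult_def Let_def)
  qed (simp add: t_fold_def t_smult_def Let_def)
  have zero: "t_fold n3 (0\<^sub>m ?N 1) = (t_zero n 1 n3 :: complex tensor)"
  proof (rule nth_equalityI)
    fix k assume "k < length (t_fold n3 (0\<^sub>m ?N 1 :: complex mat))"
    hence k: "k < n3" by (simp add: t_fold_def Let_def)
    have "k * n + i < ?N" if "i < n" for i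
    proof -
      have "k * n + i < Suc k * n" using that by simp
      also have "\<dots> \<le> n3 * n" using k by (intro mult_right_mono) auto
      finally show ?thesis by (simp add: mult.commute)
    qed
    thus "t_fold n3 (0\<^sub>m ?N 1 :: complex mat) ! k = t_zero n 1 n3 ! k"
      using k n3 by (intro eq_matI) (auto simp: t_fold_def t_zero_def Let_def)
  qed (simp add: t_fold_def t_zero_def Let_def)
  have inj: "M = M'" if "M \<in> carrier_mat ?N 1" "M' \<in> carrier_mat ?N 1"
    "t_fold n3 M = t_fold n3 M'" for M M' :: "complex mat"
    using arg_cong[OF that(3), of t_unfold]
    unfolding t_unfold_fold[OF that(1) n3] t_unfold_fold[OF that(2) n3] .
  have "t_eigenvalue A ev \<longleftrightarrow>
    (\<exists>M \<in> carrier_mat ?N 1. M \<noteq> 0\<^sub>m ?N 1 \<and> ?C * M = ev \<cdot>\<^sub>m M)" (is "_ \<longleftrightarrow> ?R")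
  proof
    assume "t_eigenvalue A ev"
    then obtain X where X: "X \<in> carrier_tensor n 1 n3" "X \<noteq> t_zero n 1 n3"
      "t_prod A X = t_smult ev X"
      by (auto simp: t_eigenvalue_def len dim Let_def)
    note U = t_unfold_carrier[OF X(1) n3]
    have "t_fold n3 (?C * t_unfold X) = t_fold n3 (ev \<cdot>\<^sub>m t_unfold X)"
      using X(3) by (simp add: t_prod_def len smult[OF U] t_fold_unfold[OF X(1) n3])
    hence "?C * t_unfold X = ev \<cdot>\<^sub>m t_unfold X"
      by (intro inj) (use C U in auto)
    moreover have "t_unfold X \<noteq> 0\<^sub>m ?N 1"
      using X(2) t_fold_unfold[OF X(1) n3] zero by metis
    ultimately show ?R using U by blast
  next
    assume ?R
    then obtain M where M: "M \<in> carrier_mat ?N 1" "M \<noteq> 0\<^sub>m ?N 1" "?C * M = ev \<cdot>\<^sub>m M"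
      by blast
    let ?X = "t_fold n3 M"
    have "t_prod A ?X = t_smult ev ?X"
      using M(3) by (simp add: t_prod_def len t_unfold_fold[OF M(1) n3] smult[OF M(1)])
    moreover have "?X \<noteq> t_zero n 1 n3"
      using inj[OF M(1), of "0\<^sub>m ?N 1"] M(2) zero by auto
    ultimately show "t_eigenvalue A ev"
      using t_fold_carrier[OF M(1) n3] by (auto simp: t_eigenvalue_def len dim Let_def)
  qed
  also have "\<dots> \<longleftrightarrow> eigenvalue ?C ev"
  proof
    assume ?R
    then obtain M where M: "M \<in> carrier_mat ?N 1" "M \<noteq> 0\<^sub>m ?N 1" "?C * M = ev \<cdot>\<^sub>m M"
      by blast
    have "col M 0 \<noteq> 0\<^sub>v ?N"
    proof
      assume z: "col M 0 = 0\<^sub>v ?N"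
      have "M = 0\<^sub>m ?N 1"
      proof (rule eq_matI)
        fix i j assume "i < dim_row (0\<^sub>m ?N 1 :: complex mat)" "j < dim_col (0\<^sub>m ?N 1 :: complex mat)"
        hence i: "i < ?N" "j = 0" by auto
        have "M $$ (i, 0) = col M 0 $ i" using i M(1) by (subst index_col) auto
        thus "M $$ (i, j) = 0\<^sub>m ?N 1 $$ (i, j)" using i z by simp
      qed (use M(1) in auto)
      with M(2) show False ..
    qed
    moreover have "?C *\<^sub>v col M 0 = ev \<cdot>\<^sub>v col M 0"
    proof -
      have "?C *\<^sub>v col M 0 = col (?C * M) 0" using C M(1) by (intro eq_vecI) auto
      also have "\<dots> = ev \<cdot>\<^sub>v col M 0" unfolding M(3) using M(1) by (intro eq_vecI) auto
      finally show ?thesis .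
    qed
    ultimately show "eigenvalue ?C ev"
      using C M(1) unfolding eigenvalue_def eigenvector_def
      by (intro exI[of _ "col M 0"]) (auto intro!: carrier_vecI)
  next
    assume "eigenvalue ?C ev"
    then obtain v where v: "v \<in> carrier_vec ?N" "v \<noteq> 0\<^sub>v ?N" "?C *\<^sub>v v = ev \<cdot>\<^sub>v v"
      using C by (auto simp: eigenvalue_def eigenvector_def)
    define M where "M = mat ?N 1 (\<lambda>(i, _). v $ i)"
    have M: "M \<in> carrier_mat ?N 1" and colM: "col M 0 = v" using v(1) by (auto simp: M_def)
    have "?C * M = ev \<cdot>\<^sub>m M"
    proof (rule eq_matI)
      fix i j assume "i < dim_row (ev \<cdot>\<^sub>m M)" "j < dim_col (ev \<cdot>\<^sub>m M)"
      hence i: "i < ?N" "j = 0" using M by auto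
      have "(?C * M) $$ (i, j) = (?C *\<^sub>v v) $ i" using i M C colM by simp
      thus "(?C * M) $$ (i, j) = (ev \<cdot>\<^sub>m M) $$ (i, j)" using i v M by (simp add: M_def)
    qed (use C M in auto)
    moreover have "M \<noteq> 0\<^sub>m ?N 1" using v(2) colM by auto
    ultimately show ?R using M by blast
  qed
  finally show ?thesis .
qed

text \<open>Consequently such a list has the expected length, and it always exists.\<close>

lemma linear_factors_nonzero: "(\<Prod>a\<leftarrow>as. [:- a, 1:]) \<noteq> (0 :: complex poly)"
  unfolding prod_list_zero_iff by auto

lemma t_eigenvalue_list_iff_char_poly:
  assumes A: "A \<in> carrier_tensor n n n3" and n3: "n3 > 0"
  shows "t_eigenvalue_list A evs \<longleftrightarrow> char_poly (bcirc A) = (\<Prod>a\<leftarrow>evs. [:- a, 1:])"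
proof -
  have C: "bcirc A \<in> carrier_mat (n * n3) (n * n3)" using bcirc_carrier[OF A n3] .
  have order_prod: "order x (\<Prod>a\<leftarrow>as. [:- a, 1:]) = count_list as x"
    for as and x :: complex
  proof (induction as)
    case (Cons a as)
    have "order x (\<Prod>a\<leftarrow>a # as. [:- a, 1:]) = order x [:- a, 1:] + count_list as x"
      unfolding Cons.IH[symmetric] using linear_factors_nonzero[of "a # as"]
      by (simp add: order_mult del: mult_pCons_left)
    thus ?case by (simp add: order_linear')
  qed simp
  obtain as where as: "char_poly (bcirc A) = (\<Prod>a\<leftarrow>as. [:- a, 1:])"
    using char_poly_factorized[OF C] by blast
  have "set as = {ev. t_eigenvalue A ev}"
    unfolding t_eigenvalue_iff_bcirc[OF A n3] eigenvalue_root_char_poly[OF C] as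
    by (auto simp: poly_prod_list prod_list_zero_iff)
  hence "t_eigenvalue_list A evs \<longleftrightarrow> mset evs = mset as"
    unfolding t_eigenvalue_list_def as order_prod
  proof (intro iffI conjI ballI)
    assume L: "set as = {ev. t_eigenvalue A ev}"
      and R: "set evs = {ev. t_eigenvalue A ev} \<and> (\<forall>ev\<in>set evs. count_list evs ev = count_list as ev)"
    show "mset evs = mset as"
    proof (rule multiset_eqI)
      fix x show "count (mset evs) x = count (mset as) x"
        using L R by (cases "x \<in> set evs") (auto simp: count_mset count_list_0_iff)
    qed
  next
    assume "set as = {ev. t_eigenvalue A ev}" and m: "mset evs = mset as"
    thus "set evs = {ev. t_eigenvalue A ev}" using mset_eq_setD[OF m] by simp
    show "count_list evs x = count_list as x" for x
      using arg_cong[OF m, of "\<lambda>M. count M x"] by (simp add: count_mset)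
  qed
  also have "\<dots> \<longleftrightarrow> (\<Prod>a\<leftarrow>as. [:- a, 1:]) = (\<Prod>a\<leftarrow>evs. [:- a, 1:])"
  proof
    assume "mset evs = mset as"
    hence "mset (map (\<lambda>a. [:- a, 1:]) as) = mset (map (\<lambda>a. [:- a, 1:]) evs)" by simp
    thus "(\<Prod>a\<leftarrow>as. [:- a, 1:]) = (\<Prod>a\<leftarrow>evs. [:- a, 1:])"
      unfolding prod_mset_prod_list[symmetric] by simp
  next
    assume "(\<Prod>a\<leftarrow>as. [:- a, 1:]) = (\<Prod>a\<leftarrow>evs. [:- a, 1:])"
    hence "count_list as x = count_list evs x" for x by (simp flip: order_prod)
    thus "mset evs = mset as" by (intro multiset_eqI) (simp add: count_mset)
  qed
  finally show ?thesis using as by simp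
qed

lemma length_t_eigenvalue_list:
  assumes "A \<in> carrier_tensor n n n3" "n3 > 0" "t_eigenvalue_list A evs"
  shows "length evs = n * n3"
proof -
  have "degree (\<Prod>a\<leftarrow>evs. [:- a, 1:]) = length evs"
  proof (induction evs)
    case (Cons a as)
    have "degree ([:- a, 1:] * (\<Prod>a\<leftarrow>as. [:- a, 1:])) = Suc (length as)"
      by (subst degree_mult_eq) (use Cons.IH linear_factors_nonzero[of as] in simp_all)
    thus ?case by (simp del: mult_pCons_left)
  qed simp
  thus ?thesis
    using assms t_eigenvalue_list_iff_char_poly[OF assms(1,2)]
      degree_monic_char_poly[OF bcirc_carrier[OF assms(1,2)]] by simp
qed

lemma ex_t_eigenvalue_list:
  assumes "A \<in> carrier_tensor n n n3" "n3 > 0"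
  shows "\<exists>evs. t_eigenvalue_list A evs"
  using char_poly_factorized[OF bcirc_carrier[OF assms]]
    t_eigenvalue_list_iff_char_poly[OF assms] by blast

lemma bdd_above_spectral_norm:
  "bdd_above ((\<lambda>v. vec_l2_norm (M *\<^sub>v v)) ` {v \<in> carrier_vec (dim_col M). vec_l2_norm v = 1})"
proof (rule bdd_aboveI2)
  fix v assume "v \<in> {v \<in> carrier_vec (dim_col M). vec_l2_norm v = 1}"
  hence v: "dim_vec v = dim_col M" "vec_l2_norm v = 1" by auto
  have *: "cmod (v $ j) \<le> 1" if "j < dim_col M" for j
    using member_le_L2_set[of "{..<dim_col M}" j "\<lambda>i. cmod (v $ i)"] v that
    by (simp add: vec_l2_norm_def)
  have "vec_l2_norm (M *\<^sub>v v) \<le> (\<Sum>i<dim_row M. cmod ((M *\<^sub>v v) $ i))"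
    unfolding vec_l2_norm_def dim_mult_mat_vec by (intro L2_set_le_sum) simp
  also have "\<dots> \<le> (\<Sum>i<dim_row M. \<Sum>j<dim_col M. cmod (M $$ (i, j)))"
  proof (rule sum_mono)
    fix i assume "i \<in> {..<dim_row M}"
    hence "cmod ((M *\<^sub>v v) $ i) = cmod (\<Sum>j<dim_col M. M $$ (i, j) * v $ j)"
      using v(1) by (simp add: scalar_prod_def atLeast0LessThan)
    also have "\<dots> \<le> (\<Sum>j<dim_col M. cmod (M $$ (i, j) * v $ j))" by (rule norm_sum)
    also have "\<dots> \<le> (\<Sum>j<dim_col M. cmod (M $$ (i, j)))"
      using * by (intro sum_mono) (simp add: norm_mult mult_left_le)
    finally show "cmod ((M *\<^sub>v v) $ i) \<le> (\<Sum>j<dim_col M. cmod (M $$ (i, j)))" .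
  qed
  finally show "vec_l2_norm (M *\<^sub>v v) \<le> (\<Sum>i<dim_row M. \<Sum>j<dim_col M. cmod (M $$ (i, j)))" .
qed

end

theory Submission
  imports Defs
begin

text \<open>
  The block circulant matrices \<open>M\<close> and \<open>P\<close> of \<open>A\<close> and \<open>B\<close> are real symmetric, because the
  tensor transpose corresponds to matrix transposition (\<open>transpose_bcirc\<close>), and the block
  circulant matrix of \<open>T\<close> is \<open>C = M + \<i> P\<close>: entrywise,
  \<open>M\<close> is its real and \<open>P\<close> its imaginary part (\<open>bcirc_re_im\<close>). So the t-eigenvalues
  \<open>\<alpha>\<close> and \<open>\<beta>\<close> are real, and every diagonal entry satisfies
  \<open>|\<alpha>\<^sub>j + \<i> \<beta>\<^sub>j|\<^sup>2 = \<alpha>\<^sub>j\<^sup>2 + \<beta>\<^sub>j\<^sup>2\<close>.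

  Frobenius norm: the sum of \<open>\<alpha>\<^sub>j\<^sup>2\<close> is the trace of \<open>M\<^sup>2\<close>, which by symmetry is the sum of the
  squared entries of \<open>M\<close> (\<open>sum_squared_eigenvalues_real_symmetric\<close>); likewise for \<open>\<beta>\<close> and \<open>P\<close>.
  Adding the two, the diagonal matrix has the Frobenius norm of \<open>C\<close>. As every slice of \<open>T\<close>
  occurs in \<open>n3\<close> blocks of \<open>C\<close> (\<open>frobenius_norm_bcirc\<close>), this is \<open>sqrt n3\<close> times the
  Frobenius norm of \<open>T\<close>, and \<open>sqrt n3 / n3 \<le> 1 \<le> sqrt 2\<close>.

  Spectral norm: a real symmetric matrix has a \<^emph>\<open>real\<close> eigenvector \<open>x\<close> for each of its
  eigenvalues, and \<open>C x = M x + \<i> P x\<close> then has real part \<open>M x\<close> and imaginary part \<open>P x\<close>, neither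
  of which is longer than \<open>C x\<close>. Hence the spectral norm of \<open>C\<close> bounds each \<open>|\<alpha>\<^sub>j|\<close> and each
  \<open>|\<beta>\<^sub>j|\<close> (\<open>abs_eigenvalue_re_im_le_spectral_norm\<close>), so that
  \<open>|\<alpha>\<^sub>j + \<i> \<beta>\<^sub>j|\<close> is at most \<open>sqrt 2\<close> times it, and the spectral norm of a diagonal matrix
  is governed by its largest entry (\<open>spectral_norm_mat_diag_le\<close>).
\<close>

section \<open>Eigenvalues of real symmetric matrices\<close>

definition mat_trace :: "'a :: comm_monoid_add mat \<Rightarrow> 'a" where
  "mat_trace M = (\<Sum>i<dim_row M. M $$ (i, i))"

lemma mat_trace_mult:
  assumes "M \<in> carrier_mat N N" "P \<in> carrier_mat N N"
  shows "mat_trace (M * P) = (\<Sum>i<N. \<Sum>k<N. M $$ (i, k) * P $$ (k, i))"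
  using assms by (auto simp: mat_trace_def scalar_prod_def atLeast0LessThan intro!: sum.cong)

lemma mat_trace_mult_commute:
  fixes M P :: "'a :: comm_semiring_0 mat"
  assumes "M \<in> carrier_mat N N" "P \<in> carrier_mat N N"
  shows "mat_trace (M * P) = mat_trace (P * M)"
  unfolding mat_trace_mult[OF assms] mat_trace_mult[OF assms(2,1)]
  by (subst sum.swap) (simp add: mult.commute)

text \<open>Schur triangularisation \<open>M = P U Q\<close> (\<open>Q\<close> the inverse of \<open>P\<close>) gives \<open>M\<^sup>2 = P U\<^sup>2 Q\<close>. The trace is
  invariant under similarity, and the diagonal of \<open>U\<^sup>2\<close> consists of the squares of the diagonal
  entries of the triangular \<open>U\<close>, which are the eigenvalues.\<close>

lemma sum_squared_eigenvalues:
  fixes M :: "complex mat"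
  assumes M: "M \<in> carrier_mat N N" and es: "char_poly M = (\<Prod>e\<leftarrow>es. [:- e, 1:])"
  shows "(\<Sum>e\<leftarrow>es. e\<^sup>2) = mat_trace (M * M)"
proof -
  obtain U P Q where U: "schur_decomposition M es = (U, P, Q)"
    using prod_cases3 by blast
  note schur = schur_decomposition[OF M es U]
  note wit = similar_mat_witD2[OF M conjunct1[OF schur]]
  note [simp] = wit(4-7)
  have [simp]: "X * Y \<in> carrier_mat N N"
    if "X \<in> carrier_mat N N" "Y \<in> carrier_mat N N" for X Y :: "complex mat"
    using that by (rule mult_carrier_mat)
  have diag: "diag_mat U = es" and upper: "upper_triangular U" using schur by auto
  have "M * M = P * U * Q * (P * U * Q)" using wit(3) by simp
  also have "\<dots> = P * U * (Q * (P * (U * Q)))"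
    by (simp add: assoc_mult_mat[of _ N N _ N _ N])
  also have "Q * (P * (U * Q)) = U * Q"
    using assoc_mult_mat[of Q N N P N "U * Q" N] left_mult_one_mat[of "U * Q" N N]
    by (simp add: wit(2))
  finally have "mat_trace (M * M) = mat_trace (P * (U * (U * Q)))"
    by (simp add: assoc_mult_mat[of _ N N _ N _ N])
  also have "\<dots> = mat_trace (U * (U * Q) * P)"
    by (rule mat_trace_mult_commute[of _ N]) auto
  also have "U * (U * Q) * P = U * U"
    by (simp add: assoc_mult_mat[of _ N N _ N _ N] wit(2) right_mult_one_mat[of _ N N])
  also have "mat_trace (U * U) = (\<Sum>i<N. (U $$ (i, i))\<^sup>2)"
  proof -
    have "(\<Sum>k<N. U $$ (i, k) * U $$ (k, i)) = (U $$ (i, i))\<^sup>2" if i: "i < N" for i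
    proof -
      have "U $$ (i, k) * U $$ (k, i) = (if k = i then (U $$ (i, i))\<^sup>2 else 0)" if "k < N" for k
        using upper_triangularD[OF upper, of i k] upper_triangularD[OF upper, of k i] wit(5) i that
        by (cases k i rule: linorder_cases) (auto simp: power2_eq_square)
      thus ?thesis using i by simp
    qed
    thus ?thesis by (simp add: mat_trace_mult[of _ N])
  qed
  also have "\<dots> = (\<Sum>e\<leftarrow>es. e\<^sup>2)"
    using carrier_matD(1)[OF wit(5)]
    by (simp add: sum_list_sum_nth atLeast0LessThan diag_mat_def flip: diag)
  finally show ?thesis ..
qed

text \<open>For an eigenvector \<open>v\<close>, the number \<open>a \<cdot> |v|\<^sup>2\<close> is the quadratic form \<open>v\<^sup>* M v\<close>, which equals its
  own conjugate because conjugating it amounts to transposing \<open>M\<close>.\<close>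

lemma real_symmetric_char_poly_root_real:
  fixes M :: "real mat" and a :: complex
  assumes M: "M \<in> carrier_mat N N" and sym: "transpose_mat M = M"
    and root: "poly (char_poly (map_mat complex_of_real M)) a = 0"
  shows "a \<in> \<real>"
proof -
  have C: "map_mat complex_of_real M \<in> carrier_mat N N" using M by simp
  obtain v where v: "v \<in> carrier_vec N" "v \<noteq> 0\<^sub>v N"
    "map_mat complex_of_real M *\<^sub>v v = a \<cdot>\<^sub>v v"
    using root C unfolding eigenvalue_root_char_poly[OF C, symmetric]
    by (auto simp: eigenvalue_def eigenvector_def)
  have sym': "M $$ (j, i) = M $$ (i, j)" if "i < N" "j < N" for i j
    using arg_cong[OF sym, of "\<lambda>X. X $$ (i, j)"] M that by simp
  have row: "a * v $ i = (\<Sum>j<N. complex_of_real (M $$ (i, j)) * v $ j)" if "i < N" for i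
    using arg_cong[OF v(3), of "\<lambda>w. w $ i"] M v(1) that
    by (simp add: scalar_prod_def atLeast0LessThan)
  define s where "s = (\<Sum>i<N. (cmod (v $ i))\<^sup>2)"
  have form: "a * complex_of_real s
      = (\<Sum>i<N. \<Sum>j<N. cnj (v $ i) * complex_of_real (M $$ (i, j)) * v $ j)"
  proof -
    have "a * complex_of_real s = (\<Sum>i<N. cnj (v $ i) * (a * v $ i))"
      unfolding s_def of_real_sum sum_distrib_left
      by (intro sum.cong) (simp_all only: complex_norm_square mult_ac)
    thus ?thesis by (simp add: row sum_distrib_left mult.assoc)
  qed
  (* Conjugation exchanges the roles of i and j; swapping the sums and the symmetry of M undo this. *)
  have "cnj (a * complex_of_real s) = a * complex_of_real s"
    unfolding form cnj_sum
    by (subst sum.swap, intro sum.cong) (auto simp: sym' mult_ac)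
  hence eq: "cnj a * complex_of_real s = a * complex_of_real s" by simp
  have "s \<noteq> 0"
  proof
    assume "s = 0"
    hence "v $ i = 0" if "i < N" for i
      using that by (simp add: s_def sum_nonneg_eq_0_iff)
    with v(1,2) show False by (auto intro: eq_vecI)
  qed
  with eq have "cnj a = a" by simp
  thus ?thesis by (simp add: Reals_cnj_iff)
qed

text \<open>Being real, the root \<open>a\<close> is already a root of the characteristic polynomial over the reals, so it
  has an eigenvector in the real vector space.\<close>

lemma real_symmetric_char_poly_root_eigenvector:
  fixes M :: "real mat" and a :: complex
  assumes M: "M \<in> carrier_mat N N" and sym: "transpose_mat M = M"
    and root: "poly (char_poly (map_mat complex_of_real M)) a = 0"
  obtains x where "x \<in> carrier_vec N" "x \<noteq> 0\<^sub>v N" "M *\<^sub>v x = Re a \<cdot>\<^sub>v x"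
proof -
  have "a = complex_of_real (Re a)"
    using real_symmetric_char_poly_root_real[OF assms] by simp
  hence "poly (map_poly complex_of_real (char_poly M)) (complex_of_real (Re a)) = 0"
    using root by (simp add: of_real_hom.char_poly_hom[OF M])
  hence "poly (char_poly M) (Re a) = 0" by simp
  hence "eigenvalue M (Re a)" by (simp add: eigenvalue_root_char_poly[OF M])
  thus thesis using that M by (auto simp: eigenvalue_def eigenvector_def)
qed

text \<open>By symmetry, \<open>M\<^sub>i\<^sub>j M\<^sub>j\<^sub>i = M\<^sub>i\<^sub>j\<^sup>2\<close> in the trace of \<open>M\<^sup>2\<close>. The real parts lose nothing, as the
  eigenvalues are real.\<close>

lemma sum_squared_eigenvalues_real_symmetric:
  fixes M :: "real mat"
  assumes M: "M \<in> carrier_mat N N" and sym: "transpose_mat M = M"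
    and es: "char_poly (map_mat complex_of_real M) = (\<Prod>e\<leftarrow>es. [:- e, 1:])"
    and len: "length es = N"
  shows "(\<Sum>j<N. (Re (es ! j))\<^sup>2) = (\<Sum>i<N. \<Sum>j<N. (M $$ (i, j))\<^sup>2)"
proof -
  have real: "es ! j = complex_of_real (Re (es ! j))" if "j < N" for j
  proof -
    have "poly (char_poly (map_mat complex_of_real M)) (es ! j) = 0"
      using that len
      by (auto simp: es poly_prod_list prod_list_zero_iff image_iff intro!: bexI[of _ "es ! j"])
    thus ?thesis using real_symmetric_char_poly_root_real[OF M sym] by simp
  qed
  have sym': "M $$ (j, i) = M $$ (i, j)" if "i < N" "j < N" for i j
    using arg_cong[OF sym, of "\<lambda>X. X $$ (i, j)"] M that by simp
  have C: "map_mat complex_of_real M \<in> carrier_mat N N" using M by simp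
  have "complex_of_real (\<Sum>j<N. (Re (es ! j))\<^sup>2) = (\<Sum>j<N. (es ! j)\<^sup>2)"
    using real by simp
  also have "\<dots> = (\<Sum>e\<leftarrow>es. e\<^sup>2)" by (simp add: sum_list_sum_nth len atLeast0LessThan)
  also have "\<dots> = (\<Sum>i<N. \<Sum>j<N. complex_of_real (M $$ (i, j)) * complex_of_real (M $$ (j, i)))"
    using M by (simp add: sum_squared_eigenvalues[OF C es] mat_trace_mult[OF C C])
  also have "\<dots> = complex_of_real (\<Sum>i<N. \<Sum>j<N. (M $$ (i, j))\<^sup>2)"
    by (simp add: power2_eq_square sym')
  finally show ?thesis by (simp only: of_real_eq_iff)
qed

section \<open>The spectral norm\<close>

lemma vec_l2_norm_power2: "(vec_l2_norm v)\<^sup>2 = (\<Sum>i<dim_vec v. (cmod (v $ i))\<^sup>2)"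
  by (simp add: vec_l2_norm_def L2_set_def sum_nonneg)

lemma vec_l2_norm_nonneg: "vec_l2_norm v \<ge> 0"
  by (simp add: vec_l2_norm_def L2_set_nonneg)

lemma vec_l2_norm_smult: "vec_l2_norm (c \<cdot>\<^sub>v v) = cmod c * vec_l2_norm v"
proof -
  have "L2_set (\<lambda>i. cmod ((c \<cdot>\<^sub>v v) $ i)) {..<dim_vec v}
      = L2_set (\<lambda>i. cmod c * cmod (v $ i)) {..<dim_vec v}"
    by (intro L2_set_cong) (auto simp: norm_mult)
  thus ?thesis by (simp add: vec_l2_norm_def L2_set_right_distrib)
qed

lemma vec_l2_norm_eq_0_iff: "vec_l2_norm v = 0 \<longleftrightarrow> v = 0\<^sub>v (dim_vec v)"
  by (auto simp: vec_l2_norm_def L2_set_eq_0_iff intro: eq_vecI)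
     (metis index_zero_vec(1))

text \<open>The spectral norm is a supremum over unit vectors only; other vectors are rescaled.\<close>

lemma vec_l2_norm_mult_mat_vec_le:
  assumes v: "v \<in> carrier_vec (dim_col M)"
  shows "vec_l2_norm (M *\<^sub>v v) \<le> spectral_norm M * vec_l2_norm v"
proof (cases "vec_l2_norm v = 0")
  case True
  hence "v = 0\<^sub>v (dim_col M)" using v by (simp add: vec_l2_norm_eq_0_iff)
  hence "vec_l2_norm (M *\<^sub>v v) = 0" by (auto simp: vec_l2_norm_eq_0_iff intro!: eq_vecI)
  thus ?thesis using True by simp
next
  case False
  define c where "c = complex_of_real (inverse (vec_l2_norm v))"
  have cmod_c: "cmod c = inverse (vec_l2_norm v)"
    using vec_l2_norm_nonneg[of v] by (simp add: c_def norm_inverse del: of_real_inverse)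
  hence c: "cmod c * vec_l2_norm v = 1" using False by simp
  have "vec_l2_norm (M *\<^sub>v (c \<cdot>\<^sub>v v)) \<le> spectral_norm M"
    unfolding spectral_norm_def
    by (rule cSUP_upper[OF _ bdd_above_spectral_norm]) (use v c in \<open>simp add: vec_l2_norm_smult\<close>)
  moreover have "M *\<^sub>v (c \<cdot>\<^sub>v v) = c \<cdot>\<^sub>v (M *\<^sub>v v)"
    using v by (intro mult_mat_vec) auto
  ultimately show ?thesis
    using False vec_l2_norm_nonneg[of v]
    by (simp add: vec_l2_norm_smult cmod_c field_simps)
qed

lemma spectral_norm_mat_diag_le:
  assumes N: "N > 0" and d: "\<And>i. i < N \<Longrightarrow> cmod (d i) \<le> c"
  shows "spectral_norm (mat_diag N d) \<le> c"
  unfolding spectral_norm_def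
proof (rule cSUP_least)
  have "vec_l2_norm (unit_vec N 0) = 1"
    using N by (simp add: vec_l2_norm_def L2_set_def if_distrib[of cmod] if_distrib[of "\<lambda>x. x\<^sup>2"]
        cong: if_cong)
  thus "{v \<in> carrier_vec (dim_col (mat_diag N d)). vec_l2_norm v = 1} \<noteq> {}"
    by (auto simp: mat_diag_def intro!: exI[of _ "unit_vec N 0"])
next
  fix v assume "v \<in> {v \<in> carrier_vec (dim_col (mat_diag N d)). vec_l2_norm v = 1}"
  hence v: "v \<in> carrier_vec N" "vec_l2_norm v = 1" by (auto simp: mat_diag_def)
  have c: "c \<ge> 0" using norm_ge_zero d[OF N] by (rule order_trans)
  have comp: "(mat_diag N d *\<^sub>v v) $ i = d i * v $ i" if "i < N" for i
  proof -
    have "(mat_diag N d *\<^sub>v v) $ i = (\<Sum>j<N. (if i = j then d j else 0) * v $ j)"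
      using that v by (simp add: mat_diag_def scalar_prod_def atLeast0LessThan)
    also have "\<dots> = (\<Sum>j<N. if i = j then d j * v $ j else 0)" by (intro sum.cong) auto
    finally show ?thesis using that by simp
  qed
  have "(vec_l2_norm (mat_diag N d *\<^sub>v v))\<^sup>2 = (\<Sum>i<N. (cmod (d i))\<^sup>2 * (cmod (v $ i))\<^sup>2)"
    unfolding vec_l2_norm_power2
    by (intro sum.cong)
      (auto simp: comp norm_mult power_mult_distrib carrier_matD(1)[OF mat_diag_dim]
        simp del: index_mult_mat_vec)
  also have "\<dots> \<le> (\<Sum>i<N. c\<^sup>2 * (cmod (v $ i))\<^sup>2)"
    by (intro sum_mono mult_right_mono power_mono d) auto
  also have "\<dots> = c\<^sup>2 * (vec_l2_norm v)\<^sup>2"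
    using v(1) by (simp add: vec_l2_norm_power2 sum_distrib_left)
  finally show "vec_l2_norm (mat_diag N d *\<^sub>v v) \<le> c"
    using v(2) c by - (rule power2_le_imp_le, simp_all)
qed

text \<open>For real \<open>x\<close>, the entries of \<open>C x\<close> have the entries of \<open>M x\<close> and \<open>P x\<close> as real and imaginary
  parts, so \<open>C\<close> stretches a real eigenvector of \<open>M\<close> or of \<open>P\<close> at least as much as that matrix
  does.\<close>

lemma abs_eigenvalue_re_im_le_spectral_norm:
  fixes M P :: "real mat" and C :: "complex mat"
  assumes M: "M \<in> carrier_mat N N" and P: "P \<in> carrier_mat N N" and C: "C \<in> carrier_mat N N"
    and entries: "\<And>i j. i < N \<Longrightarrow> j < N \<Longrightarrow> C $$ (i, j) = Complex (M $$ (i, j)) (P $$ (i, j))"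
    and x: "x \<in> carrier_vec N" "x \<noteq> 0\<^sub>v N"
    and eig: "M *\<^sub>v x = r \<cdot>\<^sub>v x \<or> P *\<^sub>v x = r \<cdot>\<^sub>v x"
  shows "\<bar>r\<bar> \<le> spectral_norm C"
proof -
  define v where "v = map_vec complex_of_real x"
  have v: "v \<in> carrier_vec N" using x by (simp add: v_def)
  have comp: "(C *\<^sub>v v) $ i = Complex ((M *\<^sub>v x) $ i) ((P *\<^sub>v x) $ i)" if "i < N" for i
    using that M P C x
    by (simp add: v_def scalar_prod_def atLeast0LessThan complex_eq_iff entries)
  have le: "\<bar>r * x $ i\<bar> \<le> cmod ((C *\<^sub>v v) $ i)" if i: "i < N" for i
    using eig abs_Re_le_cmod[of "(C *\<^sub>v v) $ i"] abs_Im_le_cmod[of "(C *\<^sub>v v) $ i"] x i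
    by (auto simp: comp)
  have "\<bar>r\<bar> * vec_l2_norm v = vec_l2_norm (complex_of_real r \<cdot>\<^sub>v v)"
    by (simp add: vec_l2_norm_smult)
  also have "\<dots> \<le> vec_l2_norm (C *\<^sub>v v)"
    unfolding vec_l2_norm_def using C x le
    by (auto simp: v_def norm_mult abs_mult intro!: L2_set_mono)
  also have "\<dots> \<le> spectral_norm C * vec_l2_norm v"
    using v C by (intro vec_l2_norm_mult_mat_vec_le) auto
  finally have "\<bar>r\<bar> * vec_l2_norm v \<le> spectral_norm C * vec_l2_norm v" .
  moreover have "v \<noteq> 0\<^sub>v N"
  proof
    assume "v = 0\<^sub>v N"
    hence "x $ i = 0" if "i < N" for i
      using arg_cong[of v "0\<^sub>v N" "\<lambda>w. w $ i"] that x(1) by (simp add: v_def)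
    with x show False by (auto intro: eq_vecI)
  qed
  hence "vec_l2_norm v > 0"
    using v vec_l2_norm_nonneg[of v] vec_l2_norm_eq_0_iff[of v] by auto
  ultimately show ?thesis by simp
qed

section \<open>Block circulant matrices\<close>

lemma bcirc_index:
  assumes A: "A \<in> carrier_tensor n1 n2 n3" and r: "r < n1 * n3" "c < n2 * n3"
  shows "bcirc A $$ (r, c) = A ! ((r div n1 + n3 - c div n2) mod n3) $$ (r mod n1, c mod n2)"
proof -
  have "n3 > 0" using r by (cases n3) auto
  thus ?thesis
    using A r carrier_tensor_nth[OF A, of 0] by (auto simp: bcirc_def Let_def carrier_tensor_def)
qed

text \<open>With slices numbered from 0, keeping the first slice and reversing the others is the index map
  \<open>k \<mapsto> -k\<close> modulo \<open>n3\<close>.\<close>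

lemma t_symmetric_nth:
  assumes A: "A \<in> carrier_tensor n n n3" and sym: "t_symmetric A" and k: "k < n3"
  shows "A ! ((n3 - k) mod n3) = transpose_mat (A ! k)"
proof -
  have len: "length A = n3" using A by (simp add: carrier_tensor_def)
  then obtain M Ms where MMs: "A = M # Ms" using k by (cases A) auto
  have eq: "A = transpose_mat M # rev (map transpose_mat Ms)"
    using sym by (simp add: t_symmetric_def MMs)
  show ?thesis
  proof (cases k)
    case 0
    thus ?thesis using eq MMs by simp
  next
    case (Suc l)
    have l: "l < length Ms" using k len MMs Suc by simp
    have "n3 - k = Suc (length Ms - Suc l)" using len MMs Suc l by simp
    moreover have "(n3 - k) mod n3 = n3 - k" using k Suc by simp
    ultimately have "A ! ((n3 - k) mod n3) = rev (map transpose_mat Ms) ! (length Ms - Suc l)"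
      by (subst eq) simp
    thus ?thesis using l MMs Suc by (simp add: rev_nth)
  qed
qed

lemma block_index:
  assumes "r < n * (n3 :: nat)"
  shows "r div n < n3" "r mod n < n"
proof -
  have "n > 0" using assms by (cases n) auto
  thus "r div n < n3" "r mod n < n" using assms by (auto simp: less_mult_imp_div_less mult.commute)
qed

text \<open>This is \<open>b - a = -(a - b)\<close> modulo \<open>m\<close>; the summands \<open>m\<close> keep the subtractions from being
  truncated.\<close>

lemma mod_diff_swap:
  fixes a b m :: nat
  assumes "a < m" "b < m"
  shows "(b + m - a) mod m = (m - (a + m - b) mod m) mod m"
proof (cases "b \<le> a")
  case True
  have "(a + m - b) mod m = ((a - b) + m) mod m"
    using True by (intro arg_cong2[of _ _ _ _ "(mod)"]) auto
  also have "\<dots> = a - b" using assms by simp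
  finally have "(a + m - b) mod m = a - b" .
  moreover have "b + m - a = m - (a - b)" using True assms by arith
  ultimately show ?thesis by (simp only:)
next
  case False
  have "(b + m - a) mod m = ((b - a) + m) mod m"
    using False by (intro arg_cong2[of _ _ _ _ "(mod)"]) auto
  also have "\<dots> = b - a" using assms by simp
  finally have "(b + m - a) mod m = b - a" .
  moreover have "(a + m - b) mod m = m - (b - a)"
    using False assms by (subst mod_less) auto
  moreover have "m - (m - (b - a)) = b - a" using assms by arith
  ultimately show ?thesis using assms by (simp only:) simp
qed

text \<open>Transposing the block circulant matrix transposes each block and puts slice \<open>j - i\<close> where slice
  \<open>i - j\<close> stood, which is what the symmetry of the tensor compensates.\<close>

lemma transpose_bcirc:
  assumes A: "A \<in> carrier_tensor n n n3" and sym: "t_symmetric A" and n3: "n3 > 0"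
  shows "transpose_mat (bcirc A) = bcirc A"
proof (rule eq_matI)
  note C = bcirc_carrier[OF A n3]
  fix r c assume "r < dim_row (bcirc A)" "c < dim_col (bcirc A)"
  hence rc: "r < n * n3" "c < n * n3" using C by auto
  define k where "k = (r div n + n3 - c div n) mod n3"
  have k: "k < n3" using n3 by (simp add: k_def)
  have "(c div n + n3 - r div n) mod n3 = (n3 - k) mod n3"
    unfolding k_def using block_index rc by (intro mod_diff_swap) auto
  hence "bcirc A $$ (c, r) = transpose_mat (A ! k) $$ (c mod n, r mod n)"
    by (simp add: bcirc_index[OF A rc(2,1)] t_symmetric_nth[OF A sym k])
  also have "\<dots> = A ! k $$ (r mod n, c mod n)"
    using carrier_tensor_nth[OF A k] block_index rc by auto
  also have "\<dots> = bcirc A $$ (r, c)" by (simp add: bcirc_index[OF A rc] k_def)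
  finally show "transpose_mat (bcirc A) $$ (r, c) = bcirc A $$ (r, c)" using C rc by simp
qed (use bcirc_carrier[OF A n3] in auto)

lemma t_of_real_carrier:
  "A \<in> carrier_tensor n1 n2 n3 \<Longrightarrow> t_of_real A \<in> carrier_tensor n1 n2 n3"
  by (auto simp: carrier_tensor_def t_of_real_def)

lemma bcirc_t_of_real:
  assumes A: "A \<in> carrier_tensor n1 n2 n3" and n3: "n3 > 0"
  shows "bcirc (t_of_real A) = map_mat complex_of_real (bcirc A)"
proof -
  note A' = t_of_real_carrier[OF A]
  have len: "length A = n3" using A by (simp add: carrier_tensor_def)
  note C = bcirc_carrier[OF A n3] and C' = bcirc_carrier[OF A' n3]
  show ?thesis
  proof (rule eq_matI)
    fix r c assume "r < dim_row (map_mat complex_of_real (bcirc A))"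
      "c < dim_col (map_mat complex_of_real (bcirc A))"
    hence rc: "r < n1 * n3" "c < n2 * n3" using C by auto
    define k where "k = (r div n1 + n3 - c div n2) mod n3"
    have k: "k < n3" using n3 by (simp add: k_def)
    show "bcirc (t_of_real A) $$ (r, c) = map_mat complex_of_real (bcirc A) $$ (r, c)"
      using rc C k carrier_tensor_nth[OF A k] block_index[OF rc(1)] block_index[OF rc(2)]
      unfolding bcirc_index[OF A' rc] k_def[symmetric]
      by (simp add: bcirc_index[OF A rc] t_of_real_def len flip: k_def)
  qed (use C C' in auto)
qed

lemma re_im_tensor_carrier:
  assumes "A \<in> carrier_tensor n1 n2 n3" "B \<in> carrier_tensor n1 n2 n3"
  shows "t_add (t_of_real A) (t_smult \<i> (t_of_real B)) \<in> carrier_tensor n1 n2 n3"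
proof -
  let ?T = "t_add (t_of_real A) (t_smult \<i> (t_of_real B))"
  have len: "length A = n3" "length B = n3" using assms by (auto simp: carrier_tensor_def)
  hence lT: "length ?T = n3" by (simp add: t_add_def t_of_real_def t_smult_def)
  have "?T ! k \<in> carrier_mat n1 n2" if "k < n3" for k
    using that len carrier_tensor_nth[OF assms(1) that] carrier_tensor_nth[OF assms(2) that]
    by (simp add: t_add_def t_of_real_def t_smult_def)
  thus ?thesis using lT by (auto simp: carrier_tensor_def in_set_conv_nth)
qed

lemma bcirc_re_im:
  assumes A: "A \<in> carrier_tensor n1 n2 n3" and B: "B \<in> carrier_tensor n1 n2 n3"
    and rc: "r < n1 * n3" "c < n2 * n3"
  shows "bcirc (t_add (t_of_real A) (t_smult \<i> (t_of_real B))) $$ (r, c)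
    = Complex (bcirc A $$ (r, c)) (bcirc B $$ (r, c))"
proof -
  have n3: "n3 > 0" using rc by (cases n3) auto
  have len: "length A = n3" "length B = n3" using A B by (auto simp: carrier_tensor_def)
  define k where "k = (r div n1 + n3 - c div n2) mod n3"
  have k: "k < n3" using n3 by (simp add: k_def)
  show ?thesis
    using rc k carrier_tensor_nth[OF A k] carrier_tensor_nth[OF B k] block_index[OF rc(1)]
      block_index[OF rc(2)] len
    unfolding bcirc_index[OF re_im_tensor_carrier[OF A B] rc] bcirc_index[OF A rc]
      bcirc_index[OF B rc] k_def[symmetric]
    by (simp add: t_add_def t_of_real_def t_smult_def complex_eq_iff)
qed

lemma sum_blocks:
  fixes f :: "nat \<Rightarrow> nat \<Rightarrow> 'a :: comm_monoid_add"
  shows "(\<Sum>r<n * m. f (r div n) (r mod n)) = (\<Sum>p<m. \<Sum>i<n. f p i)"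
proof (cases "n = 0")
  case False
  hence n: "n > 0" by simp
  have "(\<Sum>r<n * m. f (r div n) (r mod n)) = (\<Sum>(p, i)\<in>{..<m} \<times> {..<n}. f p i)"
  proof (rule sum.reindex_bij_witness[of _ "\<lambda>(p, i). p * n + i" "\<lambda>r. (r div n, r mod n)"])
    fix x assume "x \<in> {..<m} \<times> {..<n}"
    then obtain p i where x: "x = (p, i)" "p < m" "i < n" by auto
    have "p * n + i < Suc p * n" using x by simp
    also have "\<dots> \<le> m * n" using x by (intro mult_right_mono) auto
    finally show "(case x of (p, i) \<Rightarrow> p * n + i) \<in> {..<n * m}" using x by (simp add: mult.commute)
  qed (use n block_index in auto)
  thus ?thesis by (simp add: sum.cartesian_product)
qed simp

lemma sum_mod_shift:
  fixes f :: "nat \<Rightarrow> 'a :: comm_monoid_add"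
  assumes q: "q < m"
  shows "(\<Sum>p<m. f ((p + m - q) mod m)) = (\<Sum>p<m. f p)"
proof (rule sum.reindex_bij_witness[of _ "\<lambda>p. (p + q) mod m" "\<lambda>p. (p + m - q) mod m"])
  fix p assume p: "p \<in> {..<m}"
  have "((p + m - q) mod m + q) mod m = (p + m) mod m"
    using q by (simp add: mod_simps)
  thus "((p + m - q) mod m + q) mod m = p" using p by simp
  show "((p + q) mod m + m - q) mod m = p"
  proof (cases "p + q < m")
    case False
    hence "(p + q) mod m = p + q - m" using p q by (simp add: mod_if)
    thus ?thesis using False p by simp
  qed (use p in simp)
qed (use q in auto)

text \<open>Within each block column the block index runs once through all residues modulo \<open>n3\<close>, so each of
  the \<open>n3\<close> block columns contributes the squared norm of the whole tensor.\<close>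

lemma frobenius_norm_bcirc:
  assumes A: "A \<in> carrier_tensor n1 n2 n3" and n3: "n3 > 0"
  shows "(frobenius_norm (bcirc A))\<^sup>2 = real n3 * (t_frobenius_norm A)\<^sup>2"
proof -
  define g where "g k = (\<Sum>i<n1. \<Sum>j<n2. (cmod (A ! k $$ (i, j)))\<^sup>2)" for k
  have len: "length A = n3" using A by (simp add: carrier_tensor_def)
  have T: "(t_frobenius_norm A)\<^sup>2 = (\<Sum>k<n3. g k)"
  proof -
    have "(\<Sum>i<dim_row (A ! k). \<Sum>j<dim_col (A ! k). (cmod (A ! k $$ (i, j)))\<^sup>2) = g k"
      if "k < n3" for k
      using carrier_tensor_nth[OF A that] by (simp add: g_def)
    moreover have "g k \<ge> 0" for k by (simp add: g_def sum_nonneg)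
    ultimately show ?thesis by (simp add: t_frobenius_norm_def len sum_nonneg)
  qed
  have "(frobenius_norm (bcirc A))\<^sup>2 = (\<Sum>r<n1 * n3. \<Sum>c<n2 * n3. (cmod (bcirc A $$ (r, c)))\<^sup>2)"
    using bcirc_carrier[OF A n3] by (simp add: frobenius_norm_def sum_nonneg)
  also have "\<dots> = (\<Sum>r<n1 * n3. \<Sum>c<n2 * n3.
      (cmod (A ! ((r div n1 + n3 - c div n2) mod n3) $$ (r mod n1, c mod n2)))\<^sup>2)"
    by (intro sum.cong) (auto simp: bcirc_index[OF A])
  also have "\<dots> = (\<Sum>p<n3. \<Sum>i<n1. \<Sum>q<n3. \<Sum>j<n2. (cmod (A ! ((p + n3 - q) mod n3) $$ (i, j)))\<^sup>2)"
    unfolding sum_blocks[of "\<lambda>q j. (cmod (A ! ((_ + n3 - q) mod n3) $$ (_, j)))\<^sup>2"]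
      sum_blocks[of "\<lambda>p i. \<Sum>q<n3. \<Sum>j<n2. (cmod (A ! ((p + n3 - q) mod n3) $$ (i, j)))\<^sup>2"] ..
  also have "\<dots> = (\<Sum>p<n3. \<Sum>q<n3. g ((p + n3 - q) mod n3))"
    unfolding g_def by (intro sum.cong refl sum.swap)
  also have "\<dots> = (\<Sum>q<n3. \<Sum>p<n3. g ((p + n3 - q) mod n3))" by (rule sum.swap)
  also have "\<dots> = (\<Sum>q<n3. \<Sum>p<n3. g p)" 
    by (rule sum.cong[OF refl]) (simp add: sum_mod_shift)
  finally show ?thesis by (simp add: T)
qed

section \<open>Bounds for the paired t-eigenvalues\<close>

theorem theorem5p5:
  fixes n n3 :: nat
    and A B :: "real tensor"
    and T :: "complex tensor"
    and \<alpha> \<beta> :: "complex list"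
  assumes "n \<ge> 1" and "n3 \<ge> 1"
    and "A \<in> carrier_tensor n n n3" and "B \<in> carrier_tensor n n n3"
    and "t_symmetric A" and "t_symmetric B"
    and "T = t_add (t_of_real A) (t_smult \<i> (t_of_real B))"
    and "t_eigenvalue_list (t_of_real A) \<alpha>" and "t_eigenvalue_list (t_of_real B) \<beta>"
    and "sorted_wrt (\<lambda>x y. cmod x \<ge> cmod y) \<alpha>" and "sorted_wrt (\<lambda>x y. cmod x \<ge> cmod y) \<beta>"
  shows "1 / real n3 * frobenius_norm (mat_diag (n * n3) (\<lambda>j. \<alpha> ! j + \<i> * \<beta> ! j))
           \<le> sqrt 2 * t_frobenius_norm T \<and>
         spectral_norm (mat_diag (n * n3) (\<lambda>j. \<alpha> ! j + \<i> * \<beta> ! j))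
           \<le> sqrt 2 * t_spectral_norm T"
proof -
  define N where "N = n * n3"
  have n3: "n3 > 0" and N: "N > 0" using assms(1,2) by (auto simp: N_def)
  note A = assms(3) and B = assms(4)
  define M P where "M = bcirc A" and "P = bcirc B"
  have M: "M \<in> carrier_mat N N" and P: "P \<in> carrier_mat N N"
    using bcirc_carrier[OF A n3] bcirc_carrier[OF B n3] by (simp_all add: M_def P_def N_def)
  have symM: "transpose_mat M = M" and symP: "transpose_mat P = P"
    unfolding M_def P_def using transpose_bcirc A B assms(5,6) n3 by blast+
  have T: "T \<in> carrier_tensor n n n3" unfolding assms(7) by (rule re_im_tensor_carrier[OF A B])
  have C: "bcirc T \<in> carrier_mat N N" using bcirc_carrier[OF T n3] by (simp add: N_def)
  have entries: "bcirc T $$ (i, j) = Complex (M $$ (i, j)) (P $$ (i, j))" if "i < N" "j < N" for i j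
    using that bcirc_re_im[OF A B] by (simp add: assms(7) M_def P_def N_def)
  note A' = t_of_real_carrier[OF A] and B' = t_of_real_carrier[OF B]
  have cpA: "char_poly (map_mat complex_of_real M) = (\<Prod>a\<leftarrow>\<alpha>. [:- a, 1:])"
    using assms(8) unfolding t_eigenvalue_list_iff_char_poly[OF A' n3] bcirc_t_of_real[OF A n3] M_def .
  have cpB: "char_poly (map_mat complex_of_real P) = (\<Prod>a\<leftarrow>\<beta>. [:- a, 1:])"
    using assms(9) unfolding t_eigenvalue_list_iff_char_poly[OF B' n3] bcirc_t_of_real[OF B n3] P_def .
  have lenA: "length \<alpha> = N" and lenB: "length \<beta> = N"
    using length_t_eigenvalue_list[OF A' n3 assms(8)] length_t_eigenvalue_list[OF B' n3 assms(9)]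
    by (simp_all add: N_def)
  have rootA: "poly (char_poly (map_mat complex_of_real M)) (\<alpha> ! j) = 0" if "j < N" for j
    using that lenA
    by (auto simp: cpA poly_prod_list prod_list_zero_iff image_iff intro!: bexI[of _ "\<alpha> ! j"])
  have rootB: "poly (char_poly (map_mat complex_of_real P)) (\<beta> ! j) = 0" if "j < N" for j
    using that lenB
    by (auto simp: cpB poly_prod_list prod_list_zero_iff image_iff intro!: bexI[of _ "\<beta> ! j"])
  have cmod2: "(cmod (\<alpha> ! j + \<i> * \<beta> ! j))\<^sup>2 = (Re (\<alpha> ! j))\<^sup>2 + (Re (\<beta> ! j))\<^sup>2" if j: "j < N" for j
  proof -
    have "Im (\<alpha> ! j) = 0" "Im (\<beta> ! j) = 0"
      using real_symmetric_char_poly_root_real[OF M symM rootA[OF j]]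
        real_symmetric_char_poly_root_real[OF P symP rootB[OF j]]
      by (simp_all add: complex_is_Real_iff)
    thus ?thesis by (simp add: cmod_power2)
  qed
  let ?D = "mat_diag N (\<lambda>j. \<alpha> ! j + \<i> * \<beta> ! j)"

  have "(frobenius_norm ?D)\<^sup>2 = (\<Sum>i<N. \<Sum>j<N. (cmod (if i = j then \<alpha> ! j + \<i> * \<beta> ! j else 0))\<^sup>2)"
    by (simp add: frobenius_norm_def mat_diag_def sum_nonneg)
  also have "\<dots> = (\<Sum>i<N. \<Sum>j<N. if i = j then (cmod (\<alpha> ! j + \<i> * \<beta> ! j))\<^sup>2 else 0)"
    by (intro sum.cong) auto
  also have "\<dots> = (\<Sum>j<N. (Re (\<alpha> ! j))\<^sup>2) + (\<Sum>j<N. (Re (\<beta> ! j))\<^sup>2)"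
    by (simp add: cmod2 sum.distrib)
  also have "\<dots> = (\<Sum>i<N. \<Sum>j<N. (M $$ (i, j))\<^sup>2 + (P $$ (i, j))\<^sup>2)"
    using sum_squared_eigenvalues_real_symmetric[OF M symM cpA lenA]
      sum_squared_eigenvalues_real_symmetric[OF P symP cpB lenB] by (simp add: sum.distrib)
  also have "\<dots> = (frobenius_norm (bcirc T))\<^sup>2"
    using C by (simp add: frobenius_norm_def entries cmod_power2 sum_nonneg)
  also have "\<dots> = real n3 * (t_frobenius_norm T)\<^sup>2" by (rule frobenius_norm_bcirc[OF T n3])
  finally have frob: "(frobenius_norm ?D)\<^sup>2 = real n3 * (t_frobenius_norm T)\<^sup>2" .
  have "1 / real n3 * frobenius_norm ?D \<le> sqrt 2 * t_frobenius_norm T"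
  proof (rule power2_le_imp_le)
    have "(1 / real n3 * frobenius_norm ?D)\<^sup>2 = (t_frobenius_norm T)\<^sup>2 / real n3"
      using n3 by (simp add: power_mult_distrib power_divide frob) (simp add: power2_eq_square)
    also have "\<dots> \<le> (t_frobenius_norm T)\<^sup>2"
      using assms(2) by (simp add: divide_le_eq mult_le_cancel_left1)
    also have "\<dots> \<le> (sqrt 2 * t_frobenius_norm T)\<^sup>2" by (simp add: power_mult_distrib)
    finally show "(1 / real n3 * frobenius_norm ?D)\<^sup>2 \<le> (sqrt 2 * t_frobenius_norm T)\<^sup>2" .
    show "0 \<le> sqrt 2 * t_frobenius_norm T" by (simp add: t_frobenius_norm_def sum_nonneg)
  qed

  moreover have "spectral_norm ?D \<le> sqrt 2 * t_spectral_norm T"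
  proof (rule spectral_norm_mat_diag_le[OF N])
    fix j assume j: "j < N"
    have "\<bar>Re (\<alpha> ! j)\<bar> \<le> spectral_norm (bcirc T)"
      using real_symmetric_char_poly_root_eigenvector[OF M symM rootA[OF j]]
        abs_eigenvalue_re_im_le_spectral_norm[OF M P C entries] by metis
    moreover have "\<bar>Re (\<beta> ! j)\<bar> \<le> spectral_norm (bcirc T)"
      using real_symmetric_char_poly_root_eigenvector[OF P symP rootB[OF j]]
        abs_eigenvalue_re_im_le_spectral_norm[OF M P C entries] by metis
    ultimately have "(Re (\<alpha> ! j))\<^sup>2 + (Re (\<beta> ! j))\<^sup>2 \<le> 2 * (spectral_norm (bcirc T))\<^sup>2"
      using power_mono[of "\<bar>Re (\<alpha> ! j)\<bar>" "spectral_norm (bcirc T)" 2]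
        power_mono[of "\<bar>Re (\<beta> ! j)\<bar>" "spectral_norm (bcirc T)" 2] by simp
    hence "(cmod (\<alpha> ! j + \<i> * \<beta> ! j))\<^sup>2 \<le> (sqrt 2 * t_spectral_norm T)\<^sup>2"
      by (simp add: cmod2[OF j] power_mult_distrib t_spectral_norm_def)
    moreover have "t_spectral_norm T \<ge> 0"
      using \<open>\<bar>Re (\<alpha> ! j)\<bar> \<le> spectral_norm (bcirc T)\<close> by (simp add: t_spectral_norm_def)
    ultimately show "cmod (\<alpha> ! j + \<i> * \<beta> ! j) \<le> sqrt 2 * t_spectral_norm T"
      by - (rule power2_le_imp_le, simp_all)
  qed
  ultimately show ?thesis by (simp add: N_def)
qed

end
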